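(* Each of the following graphs is a transparent rectangle visibility graph (TRVG): (i) every threshold graph; (ii) every tree; (iii) every cycle $C_n$ ($n\ge 3$); (iv) the infinite rectangular grid graph; (v) the infinite triangular grid graph; (vi) the infinite hexagonal grid graph.
   Context: A graph $G$ is a transparent rectangle visibility graph (TRVG) if its vertices can be represented by a collection of pairwise non-overlapping (interior-disjoint) rectangles in the plane whose sides are parallel to the coordinate axes, one rectangle per vertex, such that two distinct vertices are adjacent if and only if there is a horizontal or a vertical line intersecting the interiors of both of their rectangles (other rectangles lying in between do not block visibility). For infinite graphs the collection of rectangles is infinite. A threshold graph is a finite graph that can be built from the one-vertex graph by repeatedly either adding an isolated vertex or adding a universal vertex (a new vertex adjacent to all existing vertices). The infinite rectangular grid graph has vertex set $\mathbb{Z}^2$, with $(i,j)$ and $(i',j')$ adjacent iff $|i-i'|+|j-j'|=1$. The infinite triangular grid graph has vertex set $\{v_{i,j}: i,j\in\mathbb{Z}\}$ where $v_{i,j}$ is adjacent exactly to $v_{i-1,j},v_{i+1,j},v_{i,j-1},v_{i+1,j-1},v_{i-1,j+1},v_{i,j+1}$ (the triangular lattice, each vertex of degree 6). The infinite hexagonal grid graph is the honeycomb lattice (the infinite 3-regular planar graph whose faces are hexagons); equivalently, the subgraph of the infinite triangular grid graph induced by removing the vertices $v_{a+3b,a}$ for all $a,b\in\mathbb{Z}$. *)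

theory Defs
  imports Complex_Main
begin

text \<open>Graphs: a vertex set V and an adjacency relation E; only pairs of
distinct vertices of V are relevant.\<close>

definition simple_graph :: "'a set \<Rightarrow> ('a \<Rightarrow> 'a \<Rightarrow> bool) \<Rightarrow> bool" where
  "simple_graph V E \<longleftrightarrow> (\<forall>u\<in>V. \<forall>v\<in>V. E u v = E v u)"

definition rect_interior :: "real \<Rightarrow> real \<Rightarrow> real \<Rightarrow> real \<Rightarrow> (real \<times> real) set" where
  "rect_interior a b c d = {a<..<b} \<times> {c<..<d}"

definition vline :: "real \<Rightarrow> (real \<times> real) set" where
  "vline c = {p. fst p = c}"

definition hline :: "real \<Rightarrow> (real \<times> real) set" where
  "hline c = {p. snd p = c}"

definition TRVG :: "'a set \<Rightarrow> ('a \<Rightarrow> 'a \<Rightarrow> bool) \<Rightarrow> bool" where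
  "TRVG V E \<longleftrightarrow>
    (\<exists>x1 x2 y1 y2 :: 'a \<Rightarrow> real.
       let R = (\<lambda>v. rect_interior (x1 v) (x2 v) (y1 v) (y2 v)) in
       (\<forall>v\<in>V. x1 v < x2 v \<and> y1 v < y2 v) \<and>
       (\<forall>u\<in>V. \<forall>v\<in>V. u \<noteq> v \<longrightarrow> R u \<inter> R v = {}) \<and>
       (\<forall>u\<in>V. \<forall>v\<in>V. u \<noteq> v \<longrightarrow>
          (E u v \<longleftrightarrow>
             (\<exists>c. vline c \<inter> R u \<noteq> {} \<and> vline c \<inter> R v \<noteq> {}) \<or>
             (\<exists>c. hline c \<inter> R u \<noteq> {} \<and> hline c \<inter> R v \<noteq> {}))))"

inductive threshold :: "('a \<Rightarrow> 'a \<Rightarrow> bool) \<Rightarrow> 'a set \<Rightarrow> bool" for E where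
  single: "threshold E {v}"
| isolated: "threshold E V \<Longrightarrow> v \<notin> V \<Longrightarrow> (\<forall>u\<in>V. \<not> E v u \<and> \<not> E u v) \<Longrightarrow> threshold E (insert v V)"
| universal: "threshold E V \<Longrightarrow> v \<notin> V \<Longrightarrow> (\<forall>u\<in>V. E v u \<and> E u v) \<Longrightarrow> threshold E (insert v V)"

definition is_walk :: "'a set \<Rightarrow> ('a \<Rightarrow> 'a \<Rightarrow> bool) \<Rightarrow> 'a list \<Rightarrow> bool" where
  "is_walk V E xs \<longleftrightarrow> xs \<noteq> [] \<and> set xs \<subseteq> V \<and>
     (\<forall>i. i + 1 < length xs \<longrightarrow> E (xs ! i) (xs ! (i + 1)))"

definition connected_graph :: "'a set \<Rightarrow> ('a \<Rightarrow> 'a \<Rightarrow> bool) \<Rightarrow> bool" where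
  "connected_graph V E \<longleftrightarrow>
     (\<forall>u\<in>V. \<forall>v\<in>V. \<exists>xs. is_walk V E xs \<and> hd xs = u \<and> last xs = v)"

definition has_cycle :: "'a set \<Rightarrow> ('a \<Rightarrow> 'a \<Rightarrow> bool) \<Rightarrow> bool" where
  "has_cycle V E \<longleftrightarrow>
     (\<exists>xs. is_walk V E xs \<and> distinct xs \<and> length xs \<ge> 3 \<and> E (last xs) (hd xs))"

definition is_tree :: "'a set \<Rightarrow> ('a \<Rightarrow> 'a \<Rightarrow> bool) \<Rightarrow> bool" where
  "is_tree V E \<longleftrightarrow> finite V \<and> V \<noteq> {} \<and> connected_graph V E \<and> \<not> has_cycle V E"

definition cycle_adj :: "nat \<Rightarrow> nat \<Rightarrow> nat \<Rightarrow> bool" where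
  "cycle_adj n i j \<longleftrightarrow> j = (i + 1) mod n \<or> i = (j + 1) mod n"

definition rect_grid_adj :: "int \<times> int \<Rightarrow> int \<times> int \<Rightarrow> bool" where
  "rect_grid_adj p q \<longleftrightarrow> \<bar>fst p - fst q\<bar> + \<bar>snd p - snd q\<bar> = 1"

definition tri_grid_adj :: "int \<times> int \<Rightarrow> int \<times> int \<Rightarrow> bool" where
  "tri_grid_adj p q \<longleftrightarrow>
     (let (i, j) = p in
       q = (i - 1, j) \<or> q = (i + 1, j) \<or> q = (i, j - 1) \<or>
       q = (i + 1, j - 1) \<or> q = (i - 1, j + 1) \<or> q = (i, j + 1))"

text \<open>Hexagonal grid: triangular lattice with the vertices v_(a+3b, a) removed.\<close>

definition hex_vertices :: "(int \<times> int) set" where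
  "hex_vertices = UNIV - {(a + 3 * b, a) | a b. True}"

end

theory Submission
  imports Defs
begin

text \<open>A graph is a TRVG iff its edge set splits into two disjoint sets, each the edge set of an
interval graph on the same vertices (projections to the two axes). Threshold graphs are interval
graphs. A rooted tree splits into stars (a vertex with its children) centred at even depth and
stars centred at odd depth. The cycle splits into a path and an edge, the rectangular grid into its
rows and its columns. The triangular grid splits into the strips of triangles between rows
\<open>2m\<close> and \<open>2m + 1\<close>, which are squares of paths, and the zigzag paths between rows
\<open>2m - 1\<close> and \<open>2m\<close>. The hexagonal grid is an induced subgraph of the triangular one.\<close>

section \<open>Visibility between rectangles as overlap of intervals\<close>

lemma vline_meets_rect_interior_iff:
  assumes "c < d"
  shows "vline t \<inter> rect_interior a b c d \<noteq> {} \<longleftrightarrow> a < t \<and> t < b"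
proof
  assume "a < t \<and> t < b"
  moreover obtain s where "c < s" "s < d" using dense[OF assms] by blast
  ultimately have "(t, s) \<in> vline t \<inter> rect_interior a b c d"
    by (simp add: vline_def rect_interior_def)
  then show "vline t \<inter> rect_interior a b c d \<noteq> {}" by blast
qed (auto simp: vline_def rect_interior_def)

lemma hline_meets_rect_interior_iff:
  assumes "a < b"
  shows "hline t \<inter> rect_interior a b c d \<noteq> {} \<longleftrightarrow> c < t \<and> t < d"
proof
  assume "c < t \<and> t < d"
  moreover obtain s where "a < s" "s < b" using dense[OF assms] by blast
  ultimately have "(s, t) \<in> hline t \<inter> rect_interior a b c d"
    by (simp add: hline_def rect_interior_def)
  then show "hline t \<inter> rect_interior a b c d \<noteq> {}" by blast
qed (auto simp: hline_def rect_interior_def)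

lemma open_intervals_meet_iff:
  fixes a b c d :: real
  assumes "a < b" "c < d"
  shows "(\<exists>t. (a < t \<and> t < b) \<and> (c < t \<and> t < d)) \<longleftrightarrow> a < d \<and> c < b"
proof
  assume "a < d \<and> c < b"
  then have "max a c < min b d" using assms by simp
  then obtain t where "max a c < t" "t < min b d" using dense by blast
  then show "\<exists>t. (a < t \<and> t < b) \<and> (c < t \<and> t < d)" by auto
qed auto

text \<open>A vertical line meets two open rectangles iff their x-projections overlap, a horizontal
  one iff their y-projections do, and the rectangles intersect iff both projections overlap. A
  representation is therefore two interval families in which no pair overlaps on both axes.\<close>

lemma TRVG_intervalsI:
  fixes x1 x2 y1 y2 :: "'a \<Rightarrow> real"
  assumes x: "\<And>v. v \<in> V \<Longrightarrow> x1 v < x2 v" and y: "\<And>v. v \<in> V \<Longrightarrow> y1 v < y2 v"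
    and disj: "\<And>u v. \<lbrakk>u \<in> V; v \<in> V; u \<noteq> v; x1 u < x2 v; x1 v < x2 u; y1 u < y2 v; y1 v < y2 u\<rbrakk> \<Longrightarrow> False"
    and adj: "\<And>u v. \<lbrakk>u \<in> V; v \<in> V; u \<noteq> v\<rbrakk> \<Longrightarrow>
      E u v \<longleftrightarrow> (x1 u < x2 v \<and> x1 v < x2 u) \<or> (y1 u < y2 v \<and> y1 v < y2 u)"
  shows "TRVG V E"
proof -
  define R where "R v = rect_interior (x1 v) (x2 v) (y1 v) (y2 v)" for v
  have R_disj: "R u \<inter> R v = {}" if "u \<in> V" "v \<in> V" "u \<noteq> v" for u v
    using disj[OF that] unfolding R_def rect_interior_def by fastforce
  have R_adj: "E u v \<longleftrightarrow>
             (\<exists>c. vline c \<inter> R u \<noteq> {} \<and> vline c \<inter> R v \<noteq> {}) \<or>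
             (\<exists>c. hline c \<inter> R u \<noteq> {} \<and> hline c \<inter> R v \<noteq> {})"
    if "u \<in> V" "v \<in> V" "u \<noteq> v" for u v
    unfolding R_def adj[OF that]
      vline_meets_rect_interior_iff[OF y[OF that(1)]] vline_meets_rect_interior_iff[OF y[OF that(2)]]
      hline_meets_rect_interior_iff[OF x[OF that(1)]] hline_meets_rect_interior_iff[OF x[OF that(2)]]
      open_intervals_meet_iff[OF x[OF that(1)] x[OF that(2)]]
      open_intervals_meet_iff[OF y[OF that(1)] y[OF that(2)]] by (rule refl)
  show ?thesis
    unfolding TRVG_def Let_def
    by (rule exI[of _ x1], rule exI[of _ x2], rule exI[of _ y1], rule exI[of _ y2], fold R_def)
       (intro conjI ballI impI x y R_disj R_adj)
qed

text \<open>The same rectangles serve: each condition on them is universal in the vertices. This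
  yields the hexagonal grid from the triangular one.\<close>

lemma TRVG_subset:
  assumes "TRVG V E" "W \<subseteq> V"
  shows "TRVG W E"
proof -
  have unary: "(\<forall>v\<in>V. P v) \<Longrightarrow> (\<forall>v\<in>W. P v)" for P
    using assms(2) by blast
  have binary: "(\<forall>u\<in>V. \<forall>v\<in>V. Q u v) \<Longrightarrow> (\<forall>u\<in>W. \<forall>v\<in>W. Q u v)" for Q
    using assms(2) by blast
  show ?thesis
    using assms(1) unfolding TRVG_def Let_def
    by (elim ex_forward conj_forward) (erule binary | erule unary)+
qed

section \<open>Cycles and grids\<close>

text \<open>Because \<open>pi < 4\<close>, every value of \<open>arctan\<close> lies strictly
  between -2 and 2, so different integers give disjoint cells of length 4; inside one cell
  \<open>arctan\<close> preserves order.\<close>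

lemma arctan_lex_less_iff:
  fixes c d :: int
  shows "4 * of_int c + arctan a < 4 * of_int d + arctan b \<longleftrightarrow> c < d \<or> c = d \<and> a < b"
proof -
  have bnd: "\<bar>arctan t\<bar> < 2" for t
    using arctan_bounded[of t] pi_less_4 by linarith
  consider "c = d" | "real_of_int c + 1 \<le> of_int d" | "real_of_int d + 1 \<le> of_int c"
    by linarith
  then show ?thesis
  proof cases
    case 1
    then show ?thesis by (simp add: arctan_less_iff)
  next
    case 2
    then show ?thesis using bnd[of a] bnd[of b] by linarith
  next
    case 3
    then show ?thesis using bnd[of a] bnd[of b] by linarith
  qed
qed

text \<open>Infinitely many bi-infinite components have to share one line: \<open>arctan\<close> squeezes each into
its own cell. Power \<open>w\<close> of a path is obtained from intervals of length \<open>w + 1/2\<close>.\<close>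

lemma TRVG_path_powersI:
  fixes c d p q :: "'a \<Rightarrow> int" and w z :: nat
  assumes disj: "\<And>u v. \<lbrakk>u \<in> V; v \<in> V; u \<noteq> v; c u = c v; \<bar>p u - p v\<bar> \<le> w; d u = d v; \<bar>q u - q v\<bar> \<le> z\<rbrakk> \<Longrightarrow> False"
    and adj: "\<And>u v. \<lbrakk>u \<in> V; v \<in> V; u \<noteq> v\<rbrakk> \<Longrightarrow>
      E u v \<longleftrightarrow> (c u = c v \<and> \<bar>p u - p v\<bar> \<le> w) \<or> (d u = d v \<and> \<bar>q u - q v\<bar> \<le> z)"
  shows "TRVG V E"
proof -
  define lo where "lo = (\<lambda>(c :: 'a \<Rightarrow> int) (p :: 'a \<Rightarrow> int) v. 4 * of_int (c v) + arctan (p v))"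
  define hi where "hi = (\<lambda>(c :: 'a \<Rightarrow> int) (p :: 'a \<Rightarrow> int) (w :: nat) v.
    4 * of_int (c v) + arctan (p v + w + 1 / 2))"
  have lt: "lo c p v < hi c p w v" for c p w v
    unfolding lo_def hi_def arctan_lex_less_iff by simp
  have meet: "lo c p u < hi c p w v \<and> lo c p v < hi c p w u \<longleftrightarrow> c u = c v \<and> \<bar>p u - p v\<bar> \<le> w" for c p w u v
  proof -
    \<comment> \<open>The half turns the strict inequality between reals into a weak one between
      integers; for \<open>w = 0\<close> only equal positions overlap.\<close>
    have "real_of_int i < real_of_int j + w + 1 / 2 \<longleftrightarrow> i \<le> j + w" for i j :: int
      by linarith
    then show ?thesis
      unfolding lo_def hi_def arctan_lex_less_iff by auto
  qed
  show ?thesis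
  proof (rule TRVG_intervalsI[of V "lo c p" "hi c p w" "lo d q" "hi d q z"])
    show False if "u \<in> V" "v \<in> V" "u \<noteq> v" "lo c p u < hi c p w v" "lo c p v < hi c p w u"
      "lo d q u < hi d q z v" "lo d q v < hi d q z u" for u v
      using disj[OF that(1-3)] meet[of c p u w v] meet[of d q u z v] that by blast
    show "E u v \<longleftrightarrow> (lo c p u < hi c p w v \<and> lo c p v < hi c p w u) \<or>
        (lo d q u < hi d q z v \<and> lo d q v < hi d q z u)" if "u \<in> V" "v \<in> V" "u \<noteq> v" for u v
      unfolding meet using adj[OF that] .
  qed (rule lt)+
qed

lemma TRVG_cycle:
  assumes "n \<ge> 3"
  shows "TRVG {0..<n} (cycle_adj n)"
proof -
  have succ: "j = (i + 1) mod n \<longleftrightarrow> j = i + 1 \<or> i = n - 1 \<and> j = 0" if "i < n" "j < n" for i j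
    using that assms by (cases "i = n - 1") auto
  have fold: "i mod (n - 1) = (if i = n - 1 then 0 else i)" if "i < n" for i
    using that assms by auto
  show ?thesis
  \<comment> \<open>The first axis carries the path 0, ..., n - 1. Reduction modulo
    \<open>n - 1\<close> identifies just \<open>n - 1\<close> with 0, so with power 0 the second
    axis carries only the closing edge. Since \<open>n >= 3\<close>, its ends are not neighbours on
    the path, which gives disjointness.\<close>
  proof (rule TRVG_path_powersI[of _ "\<lambda>_. 0" int 1 "\<lambda>i. int (i mod (n - 1))" "\<lambda>_. 0" 0])
    fix u v
    assume "u \<in> {0..<n}" "v \<in> {0..<n}" and ne: "u \<noteq> v"
    then have lt: "u < n" "v < n" by auto
    show "cycle_adj n u v \<longleftrightarrow> (0 :: int) = 0 \<and> \<bar>int u - int v\<bar> \<le> int 1 \<or>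
        int (u mod (n - 1)) = int (v mod (n - 1)) \<and> \<bar>0 - 0 :: int\<bar> \<le> int 0"
      unfolding cycle_adj_def succ[OF lt] succ[OF lt(2,1)] fold[OF lt(1)] fold[OF lt(2)]
      using lt ne assms by (auto split: if_splits)
    assume "\<bar>int u - int v\<bar> \<le> int 1" "int (u mod (n - 1)) = int (v mod (n - 1))"
    then show False
      unfolding fold[OF lt(1)] fold[OF lt(2)] using lt ne assms by (auto split: if_splits)
  qed
qed

lemma TRVG_rect_grid: "TRVG UNIV rect_grid_adj"
proof (rule TRVG_path_powersI[of _ snd fst 1 fst snd 1])
  fix u v :: "int \<times> int"
  assume "u \<noteq> v"
  then show "rect_grid_adj u v \<longleftrightarrow> snd u = snd v \<and> \<bar>fst u - fst v\<bar> \<le> int 1 \<or>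
      fst u = fst v \<and> \<bar>snd u - snd v\<bar> \<le> int 1"
    unfolding rect_grid_adj_def prod_eq_iff by (simp, linarith)
qed (auto simp: prod_eq_iff)

text \<open>The position \<open>2 * i + j mod 2\<close> walks in zigzag through the rows 2m and 2m +
  1: distance 1 gives the edges between the two rows, distance 2 the edges within a row. For the
  rows 2m - 1 and 2m the bound is 1, since the edges within rows are already covered.\<close>

lemma tri_grid_adj_strips:
  fixes i j a b :: int
  assumes "(i, j) \<noteq> (a, b)"
  shows "tri_grid_adj (i, j) (a, b) \<longleftrightarrow>
    (j div 2 = b div 2 \<and> \<bar>2 * i + j mod 2 - (2 * a + b mod 2)\<bar> \<le> 2) \<or>
    ((j + 1) div 2 = (b + 1) div 2 \<and> \<bar>2 * i + (j + 1) mod 2 - (2 * a + (b + 1) mod 2)\<bar> \<le> 1)"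
proof -
  have adj: "tri_grid_adj (i, j) (a, b) \<longleftrightarrow> b = j \<and> (a = i - 1 \<or> a = i + 1) \<or>
     b = j + 1 \<and> (a = i - 1 \<or> a = i) \<or> b = j - 1 \<and> (a = i \<or> a = i + 1)"
    unfolding tri_grid_adj_def by auto
  have near: "c = d \<or> c = d + 1 \<or> c = d - 1" if "d div 2 = c div 2" for c d :: int
    using that by presburger
  have parity: "(2 * m) div 2 = m" "(2 * m + 1) div 2 = m" "(2 * m + 2) div 2 = m + 1"
    "(2 * m + 3) div 2 = m + 1" "(2 * m - 1) div 2 = m - 1"
    "(2 * m) mod 2 = 0" "(2 * m + 1) mod 2 = 1" "(2 * m + 2) mod 2 = 0" "(2 * m + 3) mod 2 = 1"
    "(2 * m - 1) mod 2 = 1" for m :: int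
    by presburger+
  \<comment> \<open>Two consecutive rows share exactly one of the two pairings, decided by the
    parity of \<open>j\<close>; rows further apart share none. Across rows the positions differ by
    an odd number, so the bounds 1 and 2 amount to the same.\<close>
  consider "b = j" | m where "j = 2 * m" "b = 2 * m + 1" | m where "j = 2 * m" "b = 2 * m - 1"
    | m where "j = 2 * m + 1" "b = 2 * m + 2" | m where "j = 2 * m + 1" "b = 2 * m"
    | "\<not> (b = j \<or> b = j + 1 \<or> b = j - 1)"
  proof (cases "even j")
    case True
    then obtain m where "j = 2 * m" by blast
    then show ?thesis using that(1,6) that(2,3)[of m] by blast
  next
    case False
    then obtain m where m: "j = 2 * m + 1" by (rule oddE)
    then have "j + 1 = 2 * m + 2" "j - 1 = 2 * m" by simp_all
    then show ?thesis using m that(1,6) that(4,5)[of m] by metis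
  qed
  then show ?thesis
  proof cases
    case 1
    then show ?thesis using assms unfolding adj by auto
  next
    case (2 m)
    have "\<bar>2 * i + 0 - (2 * a + 1)\<bar> \<le> 2 \<longleftrightarrow> a = i - 1 \<or> a = i" by linarith
    then show ?thesis unfolding adj unfolding 2 by (simp add: parity)
  next
    case (3 m)
    have "\<bar>2 * i + 1 - (2 * a + 0)\<bar> \<le> 1 \<longleftrightarrow> a = i \<or> a = i + 1" by linarith
    then show ?thesis unfolding adj unfolding 3 by (simp add: parity)
  next
    case (4 m)
    have "\<bar>2 * i + 0 - (2 * a + 1)\<bar> \<le> 1 \<longleftrightarrow> a = i - 1 \<or> a = i" by linarith
    then show ?thesis unfolding adj unfolding 4 by (simp add: parity)
  next
    case (5 m)
    have "\<bar>2 * i + 1 - (2 * a + 0)\<bar> \<le> 2 \<longleftrightarrow> a = i \<or> a = i + 1" by linarith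
    then show ?thesis unfolding adj unfolding 5 by (simp add: parity)
  next
    case 6
    then show ?thesis unfolding adj using near[of j b] near[of "j + 1" "b + 1"] by auto
  qed
qed

lemma TRVG_tri_grid: "TRVG UNIV tri_grid_adj"
proof (rule TRVG_path_powersI[of _ "\<lambda>(i, j). j div 2" "\<lambda>(i, j). 2 * i + j mod 2" 2
      "\<lambda>(i, j). (j + 1) div 2" "\<lambda>(i, j). 2 * i + (j + 1) mod 2" 1])
  fix u v :: "int \<times> int"
  obtain i j a b where uv: "u = (i, j)" "v = (a, b)" by (cases u, cases v)
  assume ne: "u \<noteq> v"
  then show "tri_grid_adj u v \<longleftrightarrow>
      ((case u of (i, j) \<Rightarrow> j div 2) = (case v of (i, j) \<Rightarrow> j div 2) \<and>
        \<bar>(case u of (i, j) \<Rightarrow> 2 * i + j mod 2) - (case v of (i, j) \<Rightarrow> 2 * i + j mod 2)\<bar> \<le> int 2) \<or>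
      ((case u of (i, j) \<Rightarrow> (j + 1) div 2) = (case v of (i, j) \<Rightarrow> (j + 1) div 2) \<and>
        \<bar>(case u of (i, j) \<Rightarrow> 2 * i + (j + 1) mod 2) - (case v of (i, j) \<Rightarrow> 2 * i + (j + 1) mod 2)\<bar> \<le> int 1)"
    using tri_grid_adj_strips[of i j a b] by (simp add: uv)
  assume "(case u of (i, j) \<Rightarrow> j div 2) = (case v of (i, j) \<Rightarrow> j div 2)"
    "(case u of (i, j) \<Rightarrow> (j + 1) div 2) = (case v of (i, j) \<Rightarrow> (j + 1) div 2)"
  \<comment> \<open>Only equal rows agree in both pairings. The positions then differ by an even
    number of absolute value at most 1, hence coincide.\<close>
  then have "j = b" unfolding uv prod.case by presburger
  moreover assume
    "\<bar>(case u of (i, j) \<Rightarrow> 2 * i + (j + 1) mod 2) - (case v of (i, j) \<Rightarrow> 2 * i + (j + 1) mod 2)\<bar> \<le> int 1"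
  ultimately show False using ne unfolding uv by simp
qed

section \<open>Threshold graphs\<close>

lemma threshold_finite: "threshold E V \<Longrightarrow> finite V"
  by (induction rule: threshold.induct) auto

text \<open>The induction keeps all intervals inside (0, M). An isolated vertex receives (M, M + 1),
  beyond all others, and a universal vertex receives all of (0, M).\<close>

lemma threshold_interval_representation:
  assumes "threshold E V"
  shows "\<exists>(x1 :: 'a \<Rightarrow> real) x2 M. (\<forall>v\<in>V. 0 \<le> x1 v \<and> x1 v < x2 v \<and> x2 v \<le> M) \<and>
    (\<forall>u\<in>V. \<forall>v\<in>V. u \<noteq> v \<longrightarrow> (E u v \<longleftrightarrow> x1 u < x2 v \<and> x1 v < x2 u)) \<and> 0 < M"
  using assms
proof (induction rule: threshold.induct)
  case (single v)
  show ?case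
    by (rule exI[of _ "\<lambda>_. 0"], rule exI[of _ "\<lambda>_. 1"], rule exI[of _ 1]) simp
next
  case (isolated V v)
  then obtain x1 x2 :: "'a \<Rightarrow> real" and M where *:
    "\<forall>v\<in>V. 0 \<le> x1 v \<and> x1 v < x2 v \<and> x2 v \<le> M"
    "\<forall>u\<in>V. \<forall>v\<in>V. u \<noteq> v \<longrightarrow> (E u v \<longleftrightarrow> x1 u < x2 v \<and> x1 v < x2 u)" "0 < M"
    by blast
  have vV: "u \<noteq> v" if "u \<in> V" for u using isolated.hyps(2) that by blast
  show ?case
  proof (rule exI[of _ "x1(v := M)"], rule exI[of _ "x2(v := M + 1)"], rule exI[of _ "M + 1"], intro conjI ballI impI)
    fix u w
    assume "u \<in> insert v V" "w \<in> insert v V" "u \<noteq> w"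
    then consider "u \<in> V" "w \<in> V" "u \<noteq> w" | "u = v" "w \<in> V" | "u \<in> V" "w = v"
      by blast
    then show "E u w \<longleftrightarrow> (x1(v := M)) u < (x2(v := M + 1)) w \<and> (x1(v := M)) w < (x2(v := M + 1)) u"
    proof cases
      case 1
      then show ?thesis using *(2) vV by simp
    next
      case 2
      then show ?thesis using bspec[OF *(1), of w] vV[of w] isolated.hyps(3) by auto
    next
      case 3
      then show ?thesis using bspec[OF *(1), of u] vV[of u] isolated.hyps(3) by auto
    qed
  qed (use * in fastforce)+
next
  case (universal V v)
  then obtain x1 x2 :: "'a \<Rightarrow> real" and M where *:
    "\<forall>v\<in>V. 0 \<le> x1 v \<and> x1 v < x2 v \<and> x2 v \<le> M"
    "\<forall>u\<in>V. \<forall>v\<in>V. u \<noteq> v \<longrightarrow> (E u v \<longleftrightarrow> x1 u < x2 v \<and> x1 v < x2 u)" "0 < M"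
    by blast
  have vV: "u \<noteq> v" if "u \<in> V" for u using universal.hyps(2) that by blast
  show ?case
  proof (rule exI[of _ "x1(v := 0)"], rule exI[of _ "x2(v := M)"], rule exI[of _ "M"], intro conjI ballI impI)
    fix u w
    assume "u \<in> insert v V" "w \<in> insert v V" "u \<noteq> w"
    then consider "u \<in> V" "w \<in> V" "u \<noteq> w" | "u = v" "w \<in> V" | "u \<in> V" "w = v"
      by blast
    then show "E u w \<longleftrightarrow> (x1(v := 0)) u < (x2(v := M)) w \<and> (x1(v := 0)) w < (x2(v := M)) u"
    proof cases
      case 1
      then show ?thesis using *(2) vV by simp
    next
      case 2
      then show ?thesis using bspec[OF *(1), of w] vV[of w] universal.hyps(3) by auto
    next
      case 3
      then show ?thesis using bspec[OF *(1), of u] vV[of u] universal.hyps(3) by auto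
    qed
  qed (use * in fastforce)+
qed

lemma TRVG_threshold:
  assumes "threshold E V"
  shows "TRVG V E"
proof -
  obtain x1 x2 :: "'a \<Rightarrow> real" where x:
    "\<forall>v\<in>V. x1 v < x2 v" "\<forall>u\<in>V. \<forall>v\<in>V. u \<noteq> v \<longrightarrow> (E u v \<longleftrightarrow> x1 u < x2 v \<and> x1 v < x2 u)"
    using threshold_interval_representation[OF assms] by blast
  \<comment> \<open>All edges live on the first axis. On the second, unit intervals at distinct
    naturals create no visibility and keep the rectangles disjoint.\<close>
  obtain k :: "'a \<Rightarrow> nat" where k: "inj_on k V"
    using finite_imp_inj_to_nat_seg[OF threshold_finite[OF assms]] by blast
  have disj: "\<not> (real (k u) < real (k v) + 1 \<and> real (k v) < real (k u) + 1)"
    if "u \<in> V" "v \<in> V" "u \<noteq> v" for u v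
  proof -
    have "k u \<noteq> k v" using k that by (auto dest: inj_onD)
    then show ?thesis by linarith
  qed
  show ?thesis
  proof (rule TRVG_intervalsI[of V x1 x2 "\<lambda>v. real (k v)" "\<lambda>v. real (k v) + 1"])
    show False if "u \<in> V" "v \<in> V" "u \<noteq> v"
      "real (k u) < real (k v) + 1" "real (k v) < real (k u) + 1" for u v
      using disj that by blast
    show "E u v \<longleftrightarrow> (x1 u < x2 v \<and> x1 v < x2 u) \<or>
        (real (k u) < real (k v) + 1 \<and> real (k v) < real (k u) + 1)"
      if "u \<in> V" "v \<in> V" "u \<noteq> v" for u v
      using disj[OF that] x(2) that by blast
  qed (use x(1) in auto)
qed

section \<open>Trees\<close>

text \<open>Turns trees, given by walks and cycles, into an induction over added leaves. Both
  argument orders of \<open>E\<close> are recorded, so inductions over it do not appeal to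
  symmetry.\<close>

inductive grown_tree :: "('a \<Rightarrow> 'a \<Rightarrow> bool) \<Rightarrow> 'a set \<Rightarrow> bool" for E where
  single: "grown_tree E {v}"
| leaf: "grown_tree E S \<Longrightarrow> v \<notin> S \<Longrightarrow> p \<in> S \<Longrightarrow> E v p \<Longrightarrow> E p v \<Longrightarrow>
    (\<forall>u\<in>S. u \<noteq> p \<longrightarrow> \<not> E v u \<and> \<not> E u v) \<Longrightarrow> grown_tree E (insert v S)"

section \<open>Walks, and growing a tree leaf by leaf\<close>

lemma is_walk_singleton [simp]: "is_walk V E [x] \<longleftrightarrow> x \<in> V"
  by (simp add: is_walk_def)

lemma is_walk_Cons [simp]:
  "is_walk V E (x # y # xs) \<longleftrightarrow> x \<in> V \<and> E x y \<and> is_walk V E (y # xs)"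
  unfolding is_walk_def by (auto simp: nth_Cons split: nat.splits)

lemma is_walk_mono: "is_walk S E xs \<Longrightarrow> S \<subseteq> V \<Longrightarrow> is_walk V E xs"
  unfolding is_walk_def by blast

lemma is_walk_ConsI: "is_walk V E xs \<Longrightarrow> x \<in> V \<Longrightarrow> E x (hd xs) \<Longrightarrow> is_walk V E (x # xs)"
  by (cases xs) (auto simp: is_walk_def[of _ _ "[]"])

lemma is_walk_snocI: "is_walk V E xs \<Longrightarrow> x \<in> V \<Longrightarrow> E (last xs) x \<Longrightarrow> is_walk V E (xs @ [x])"
proof (induction xs rule: induct_list012)
  case 1
  then show ?case by (simp add: is_walk_def)
qed auto

text \<open>Supplies the edge along which a partial tree grows: the first step of the walk that
  leaves \<open>S\<close>.\<close>

lemma walk_leaves_set: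
  "is_walk V E xs \<Longrightarrow> hd xs \<in> S \<Longrightarrow> last xs \<notin> S \<Longrightarrow> \<exists>p\<in>S. \<exists>v\<in>V - S. E p v"
proof (induction xs rule: induct_list012)
  case 1
  then show ?case by (simp add: is_walk_def)
next
  case (2 x)
  then show ?case by simp
next
  case (3 x y zs)
  moreover have "y \<in> V" using 3 by (auto simp: is_walk_def)
  ultimately show ?case by (cases "y \<in> S") auto
qed

text \<open>A path to or from a new leaf runs through its neighbour \<open>p\<close>; the leaf lies
  outside \<open>S\<close>, so no vertex is repeated. These paths later close a forbidden
  cycle.\<close>

lemma grown_tree_path:
  assumes "grown_tree E S" "u \<in> S" "v \<in> S"
  shows "\<exists>xs. is_walk S E xs \<and> distinct xs \<and> hd xs = u \<and> last xs = v"
  using assms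
proof (induction arbitrary: u v rule: grown_tree.induct)
  case (single r)
  then show ?case by (intro exI[of _ "[r]"]) auto
next
  case (leaf S r p)
  have ne: "xs \<noteq> []" and sub: "set xs \<subseteq> S" if "is_walk S E xs" for xs
    using that by (auto simp: is_walk_def)
  consider "u \<in> S" "v \<in> S" | "u = r" "v = r" | "u = r" "v \<in> S" | "u \<in> S" "v = r"
    using leaf.prems by blast
  then show ?case
  proof cases
    case 1
    then show ?thesis using leaf.IH is_walk_mono by (metis subset_insertI)
  next
    case 2
    then show ?thesis by (intro exI[of _ "[r]"]) auto
  next
    case 3
    then obtain xs where xs: "is_walk S E xs" "distinct xs" "hd xs = p" "last xs = v"
      using leaf.IH leaf.hyps by blast
    then have "is_walk (insert r S) E (r # xs)"
      using leaf.hyps by (intro is_walk_ConsI) (auto intro: is_walk_mono)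
    then show ?thesis
      using 3 xs ne[OF xs(1)] sub[OF xs(1)] leaf.hyps by (intro exI[of _ "r # xs"]) auto
  next
    case 4
    then obtain xs where xs: "is_walk S E xs" "distinct xs" "hd xs = u" "last xs = p"
      using leaf.IH leaf.hyps by blast
    then have "is_walk (insert r S) E (xs @ [r])"
      using leaf.hyps by (intro is_walk_snocI) (auto intro: is_walk_mono)
    then show ?thesis
      using 4 xs ne[OF xs(1)] sub[OF xs(1)] leaf.hyps by (intro exI[of _ "xs @ [r]"]) auto
  qed
qed

text \<open>A second neighbour of the new vertex inside \<open>S\<close> would close a cycle.\<close>

lemma grown_tree_extend:
  assumes "simple_graph V E" "is_tree V E" "grown_tree E S" "S \<subset> V" "S \<noteq> {}"
  shows "\<exists>v\<in>V - S. grown_tree E (insert v S)"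
proof -
  obtain a b where "a \<in> S" "b \<in> V - S" using assms by blast
  moreover from this obtain xs where "is_walk V E xs" "hd xs = a" "last xs = b"
    using assms unfolding is_tree_def connected_graph_def by blast
  ultimately obtain p v where p: "p \<in> S" "v \<in> V - S" "E p v"
    using walk_leaves_set[of V E xs S] by blast
  have sym: "E x y \<longleftrightarrow> E y x" if "x \<in> V" "y \<in> V" for x y
    using assms(1) that unfolding simple_graph_def by blast
  have "\<not> E v u" if u: "u \<in> S" "u \<noteq> p" for u
  proof
    assume "E v u"
    obtain xs where xs: "is_walk S E xs" "distinct xs" "hd xs = u" "last xs = p"
      using grown_tree_path[OF assms(3)] u p by blast
    then have ne: "xs \<noteq> []" "set xs \<subseteq> S" by (auto simp: is_walk_def)
    \<comment> \<open>The ends \<open>u\<close> and \<open>p\<close> differ, so together with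
      \<open>v\<close> there are at least the three vertices that \<open>has_cycle\<close> demands;
      \<open>E p v\<close> is the closing edge.\<close>
    have "length xs \<ge> 2"
      using xs u ne by (cases xs; cases "tl xs") auto
    moreover have "is_walk V E (v # xs)"
      using xs p \<open>E v u\<close> assms(4) by (intro is_walk_ConsI) (auto intro: is_walk_mono)
    ultimately have "has_cycle V E"
      unfolding has_cycle_def using xs ne p by (intro exI[of _ "v # xs"]) auto
    then show False using assms(2) by (simp add: is_tree_def)
  qed
  moreover have "u \<in> V" if "u \<in> S" for u using that assms(4) by blast
  ultimately have "grown_tree E (insert v S)"
    using p sym by (intro grown_tree.leaf[OF assms(3), of v p]) auto
  then show ?thesis using p by blast
qed

lemma tree_imp_grown_tree:
  assumes "simple_graph V E" "is_tree V E"
  shows "grown_tree E V"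
proof -
  have fin: "finite V" and "V \<noteq> {}" using assms(2) by (auto simp: is_tree_def)
  then obtain r where r: "r \<in> V" by blast
  \<comment> \<open>A maximal grown subtree exists by finiteness and must be all of
    \<open>V\<close>, as \<open>grown_tree_extend\<close> would otherwise enlarge it.\<close>
  define \<S> where "\<S> = {S. S \<subseteq> V \<and> S \<noteq> {} \<and> grown_tree E S}"
  have "finite \<S>" "{r} \<in> \<S>"
    using fin r by (auto simp: \<S>_def intro: grown_tree.single)
  then obtain S where S: "S \<in> \<S>" "\<And>T. T \<in> \<S> \<Longrightarrow> S \<subseteq> T \<Longrightarrow> S = T"
    using finite_has_maximal[of \<S>] by blast
  have "S = V"
  proof (rule ccontr)
    assume "S \<noteq> V"
    then obtain v where "v \<in> V - S" "grown_tree E (insert v S)"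
      using grown_tree_extend[OF assms, of S] S(1) unfolding \<S>_def by blast
    then show False using S(1) S(2)[of "insert v S"] unfolding \<S>_def by blast
  qed
  then show ?thesis using S(1) by (simp add: \<S>_def)
qed

text \<open>The root is its own parent; the colour is the parity of the depth.\<close>

lemma grown_tree_parent:
  assumes "grown_tree E S"
  shows "finite S \<and> (\<exists>r par (col :: 'a \<Rightarrow> bool).
    (\<forall>v\<in>S. v \<noteq> r \<longrightarrow> par v \<in> S \<and> par v \<noteq> v \<and> par (par v) \<noteq> v \<and> col (par v) \<noteq> col v) \<and>
    par r = r \<and> r \<in> S \<and>
    (\<forall>u\<in>S. \<forall>v\<in>S. u \<noteq> v \<longrightarrow> (E u v \<longleftrightarrow> par u = v \<or> par v = u)))"
  using assms
proof (induction rule: grown_tree.induct)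
  case (single v)
  show ?case
    by (intro conjI exI[of _ v] exI[of _ id]) auto
next
  case (leaf S v p)
  then obtain r par and col :: "'a \<Rightarrow> bool" where rep: "finite S"
    "\<forall>v\<in>S. v \<noteq> r \<longrightarrow> par v \<in> S \<and> par v \<noteq> v \<and> par (par v) \<noteq> v \<and> col (par v) \<noteq> col v"
    "par r = r" "r \<in> S" "\<forall>u\<in>S. \<forall>v\<in>S. u \<noteq> v \<longrightarrow> (E u v \<longleftrightarrow> par u = v \<or> par v = u)"
    by (elim conjE exE)
  note * = rep(1) mp[OF bspec[OF rep(2)]] rep(3,4) mp[OF bspec[OF bspec[OF rep(5)]]]
  have parS: "par u \<in> S" if "u \<in> S" for u using * that by metis
  have vS: "u \<noteq> v" "par u \<noteq> v" if "u \<in> S" for u using leaf.hyps(2) that parS by blast+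
  have rv: "r \<noteq> v" using vS *(4) by blast
  show ?case
  proof (intro conjI exI[of _ r] exI[of _ "par(v := p)"] exI[of _ "col(v := \<not> col p)"] ballI impI)
    fix u w
    assume "u \<in> insert v S" "w \<in> insert v S" "u \<noteq> w"
    then consider "u \<in> S" "w \<in> S" "u \<noteq> w" | "u = v" "w \<in> S" | "u \<in> S" "w = v"
      by blast
    then show "E u w \<longleftrightarrow> (par(v := p)) u = w \<or> (par(v := p)) w = u"
    proof cases
      case 1
      then show ?thesis using *(5)[of u w] vS by simp
    next
      case 2
      then show ?thesis using vS[of w] leaf.hyps(4,6) by auto
    next
      case 3
      then show ?thesis using vS[of u] leaf.hyps(5,6) by auto
    qed
  next
    fix u
    assume "u \<in> insert v S" and r: "u \<noteq> r"
    then consider "u = v" | "u \<in> S" by blast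
    then have "(par(v := p)) u \<in> insert v S \<and> (par(v := p)) u \<noteq> u \<and>
      (par(v := p)) ((par(v := p)) u) \<noteq> u \<and> (col(v := \<not> col p)) ((par(v := p)) u) \<noteq> (col(v := \<not> col p)) u"
    proof cases
      case 1
      then show ?thesis using vS[OF leaf.hyps(3)] leaf.hyps(3) by simp
    next
      case 2
      then show ?thesis using *(2)[OF 2 r] vS[OF 2] by simp
    qed
    then show "(par(v := p)) u \<in> insert v S" "(par(v := p)) u \<noteq> u"
      "(par(v := p)) ((par(v := p)) u) \<noteq> u"
      "(col(v := \<not> col p)) ((par(v := p)) u) \<noteq> (col(v := \<not> col p)) u" by blast+
  qed (use * rv in auto)
qed

section \<open>Interval representation of a rooted tree\<close>

lemma nested_interval_bounds:
  "0 < 1 / (real n + 2)" "1 / (real n + 1) \<le> 1" "1 / (real n + 2) < 1 / (real n + 1)"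
  by (auto simp: field_simps)

lemma nested_intervals_disjoint:
  assumes "m < n"
  shows "1 / (real n + 1) \<le> 1 / (real m + 2)"
  using assms by (auto simp: field_simps)

text \<open>On axis \<open>b\<close> the vertices of colour \<open>b\<close> are star centres with
  disjoint unit intervals, and every other non-root vertex sits inside the interval of its parent.
  An edge is thus seen on the axis given by the colour of its parent end.\<close>

lemma TRVG_grown_tree:
  assumes "grown_tree E S"
  shows "TRVG S E"
proof -
  obtain r par and col :: "'a \<Rightarrow> bool" where rep: "finite S"
    "\<forall>v\<in>S. v \<noteq> r \<longrightarrow> par v \<in> S \<and> par v \<noteq> v \<and> par (par v) \<noteq> v \<and> col (par v) \<noteq> col v"
    "par r = r" "r \<in> S" "\<forall>u\<in>S. \<forall>v\<in>S. u \<noteq> v \<longrightarrow> (E u v \<longleftrightarrow> par u = v \<or> par v = u)"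
    using grown_tree_parent[OF assms] by (elim conjE exE)
  note * = rep(1) mp[OF bspec[OF rep(2)]] rep(3,4) mp[OF bspec[OF bspec[OF rep(5)]]]
  obtain k :: "'a \<Rightarrow> nat" where k: "inj_on k S"
    using finite_imp_inj_to_nat_seg[OF *(1)] by blast
  \<comment> \<open>The children of one parent occupy the disjoint pieces (1/(k+2), 1/(k+1)) of its
    unit interval. On the axis of the other colour the root has no parent star and is parked in (-1,
    0), below all cells numbered by \<open>k\<close>.\<close>
  define lo where "lo b v = (if col v = b then real (k v) else if v = r then -1
      else real (k (par v)) + 1 / (real (k v) + 2))" for b v
  define hi where "hi b v = (if col v = b then real (k v) + 1 else if v = r then 0
      else real (k (par v)) + 1 / (real (k v) + 1))" for b v
  note nb = nested_interval_bounds
  have lt: "lo b v < hi b v" for b v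
    using nb(3)[of "k v"] by (auto simp: lo_def hi_def)
  \<comment> \<open>The left end of the integer unit cell containing the interval; overlapping open
    intervals must share their cell.\<close>
  define cell where "cell b v = (if col v = b then int (k v) else if v = r then -1 else int (k (par v)))" for b v
  have in_cell: "of_int (cell b v) \<le> lo b v" "hi b v \<le> of_int (cell b v) + 1" for b v
    using nb(1,2)[of "k v"] by (auto simp: cell_def lo_def hi_def)
  have same_cell: "cell b u = cell b v" if "lo b u < hi b v" "lo b v < hi b u" for b u v
    using that in_cell[of b u] in_cell[of b v] by linarith
  have star: "lo b u < hi b v \<and> lo b v < hi b u" if "par u = v" "col v = b" "u \<in> S" "u \<noteq> v" for u v b
  proof -
    have "u \<noteq> r" using that *(3) by auto
    moreover from this have "col u \<noteq> b" using that *(2)[of u] by auto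
    ultimately show ?thesis using that nb[of "k u"] by (simp add: lo_def hi_def add_pos_pos)
  qed
  have meet: "lo b u < hi b v \<and> lo b v < hi b u \<longleftrightarrow> (par u = v \<and> col v = b) \<or> (par v = u \<and> col u = b)"
    if uv: "u \<in> S" "v \<in> S" "u \<noteq> v" for b u v
  proof
    assume m: "lo b u < hi b v \<and> lo b v < hi b u"
    then have c: "cell b u = cell b v" using same_cell by blast
    have ku: "k u \<noteq> k v" using k uv by (auto dest: inj_onD)
    \<comment> \<open>Two centres occupy distinct cells; a centre and a non-centre share one only if
      the centre is the parent; two non-centres sharing one are siblings, in disjoint
      pieces.\<close>
    consider "col u = b" "col v = b" | "col u = b" "col v \<noteq> b" | "col u \<noteq> b" "col v = b"
      | "col u \<noteq> b" "col v \<noteq> b" by blast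
    then show "(par u = v \<and> col v = b) \<or> (par v = u \<and> col u = b)"
    proof cases
      case 1
      then show ?thesis using c ku by (simp add: cell_def)
    next
      case 2
      then have "k u = k (par v)" "v \<noteq> r" using c by (auto simp: cell_def split: if_splits)
      then show ?thesis using 2 k *(2)[of v] uv by (auto dest: inj_onD)
    next
      case 3
      then have "k v = k (par u)" "u \<noteq> r" using c by (auto simp: cell_def split: if_splits)
      then show ?thesis using 3 k *(2)[of u] uv by (auto dest: inj_onD)
    next
      case 4
      then have "u \<noteq> r" "v \<noteq> r" "k (par u) = k (par v)" using c uv by (auto simp: cell_def split: if_splits)
      then show ?thesis
        using 4 m ku nested_intervals_disjoint[of "k u" "k v"] nested_intervals_disjoint[of "k v" "k u"]
        by (cases "k u < k v") (auto simp: lo_def hi_def)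
    qed
  next
    assume "(par u = v \<and> col v = b) \<or> (par v = u \<and> col u = b)"
    then show "lo b u < hi b v \<and> lo b v < hi b u"
      using star[of u v b] star[of v u b] uv by auto
  qed
  show ?thesis
  proof (rule TRVG_intervalsI[of S "lo True" "hi True" "lo False" "hi False"])
    show False if uv: "u \<in> S" "v \<in> S" "u \<noteq> v" and m: "lo True u < hi True v" "lo True v < hi True u"
      "lo False u < hi False v" "lo False v < hi False u" for u v
    proof -
      \<comment> \<open>The parent of an overlapping pair has colour \<open>True\<close> on one axis
        and \<open>False\<close> on the other, so overlap on both makes each vertex the parent of
        the other.\<close>
      have "par u = v \<and> par v = u"
        using m meet[OF uv, of True] meet[OF uv, of False] by blast
      then show False using *(2)[of u] *(3) uv by (cases "u = r") auto
    qed
    show "E u v \<longleftrightarrow> (lo True u < hi True v \<and> lo True v < hi True u) \<or>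
        (lo False u < hi False v \<and> lo False v < hi False u)" if "u \<in> S" "v \<in> S" "u \<noteq> v" for u v
      using *(5)[OF that] meet[OF that, of True] meet[OF that, of False] by blast
  qed (rule lt)+
qed

theorem theorem1:
  shows "(\<forall>(V :: 'a set) E. simple_graph V E \<and> threshold E V \<longrightarrow> TRVG V E)
       \<and> (\<forall>(V :: 'a set) E. simple_graph V E \<and> is_tree V E \<longrightarrow> TRVG V E)
       \<and> (\<forall>n::nat. n \<ge> 3 \<longrightarrow> TRVG {0..<n} (cycle_adj n))
       \<and> TRVG UNIV rect_grid_adj
       \<and> TRVG UNIV tri_grid_adj
       \<and> TRVG hex_vertices tri_grid_adj"
  using TRVG_threshold TRVG_grown_tree tree_imp_grown_tree TRVG_cycle TRVG_rect_grid TRVG_tri_grid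
    TRVG_subset[OF TRVG_tri_grid subset_UNIV]
  by blast

end
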